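(* Let $G=(V,P,d)$ be a reversible metric Markov chain with non-negative Ollivier curvature. Let $W\subset V$ with $m(W)\le\frac12$ and let $0<\varepsilon\le\frac18$. Then \[ |\partial W|\ge P_0\cdot\frac{\min(m(W),\varepsilon)\,\log(1/\varepsilon)}{6\operatorname{diam}_{\operatorname{obs}}^{(\varepsilon)}}. \]
   Context: $V$ finite; $P$ with symmetric support; $x\sim y$ iff $x\ne y$, $P(x,y)>0$; $d$ a finite path distance ($d(x,y)=\inf\sum d(x_{k-1},x_k)$ over paths $x=x_0\sim\dots\sim x_n=y$); $m$ the probability with $m(x)P(x,y)=m(y)P(y,x)$. $\Delta f(x)=\sum_yP(x,y)(f(y)-f(x))$; Ollivier curvature $\kappa(x,y)=\inf\{(\Delta f(x)-\Delta f(y))/d(x,y): f\ 1\text{-Lipschitz w.r.t. } d,\ f(y)-f(x)=d(x,y)\}$, assumed $\ge0$ for all $x\sim y$. $P_0=\inf_{x\sim y}P(x,y)d(x,y)^2$. $|\partial W|=\sum_{x\in W,y\notin W}P(x,y)m(x)d(x,y)$. $\operatorname{cl}(B)=B\cup\{x: x\sim y\text{ for some }y\in B\}$; $d(A,B)=\min_{a\in A,b\in B}d(a,b)$; $\operatorname{diam}_{\operatorname{obs}}^{(\varepsilon)}=\sup\{d(A,B): m(A)\ge\varepsilon,\ m(\operatorname{cl}(B))\ge\varepsilon\}$. *)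

theory Defs
  imports Complex_Main
begin

definition adj :: "('v \<Rightarrow> 'v \<Rightarrow> real) \<Rightarrow> 'v \<Rightarrow> 'v \<Rightarrow> bool" where
  "adj P x y \<longleftrightarrow> x \<noteq> y \<and> P x y > 0"

definition markov_kernel :: "('v::finite \<Rightarrow> 'v \<Rightarrow> real) \<Rightarrow> bool" where
  "markov_kernel P \<longleftrightarrow> (\<forall>x y. 0 \<le> P x y) \<and> (\<forall>x. (\<Sum>y\<in>UNIV. P x y) = 1)"

definition symmetric_support :: "('v \<Rightarrow> 'v \<Rightarrow> real) \<Rightarrow> bool" where
  "symmetric_support P \<longleftrightarrow> (\<forall>x y. P x y > 0 \<longleftrightarrow> P y x > 0)"

definition graph_paths :: "('v \<Rightarrow> 'v \<Rightarrow> real) \<Rightarrow> 'v \<Rightarrow> 'v \<Rightarrow> 'v list set" where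
  "graph_paths P x y = {xs. xs \<noteq> [] \<and> hd xs = x \<and> last xs = y \<and>
      (\<forall>i. Suc i < length xs \<longrightarrow> adj P (xs ! i) (xs ! Suc i))}"

definition path_length :: "('v \<Rightarrow> 'v \<Rightarrow> real) \<Rightarrow> 'v list \<Rightarrow> real" where
  "path_length d xs = (\<Sum>i<length xs - 1. d (xs ! i) (xs ! Suc i))"

definition path_distance :: "('v \<Rightarrow> 'v \<Rightarrow> real) \<Rightarrow> ('v \<Rightarrow> 'v \<Rightarrow> real) \<Rightarrow> bool" where
  "path_distance P d \<longleftrightarrow>
     (\<forall>x y. d x y = d y x) \<and> (\<forall>x y. x \<noteq> y \<longrightarrow> 0 < d x y) \<and>
     (\<forall>x y. graph_paths P x y \<noteq> {} \<and>
            d x y = (INF xs\<in>graph_paths P x y. path_length d xs))"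

definition reversible_measure :: "('v::finite \<Rightarrow> 'v \<Rightarrow> real) \<Rightarrow> ('v \<Rightarrow> real) \<Rightarrow> bool" where
  "reversible_measure P m \<longleftrightarrow> (\<forall>x. 0 \<le> m x) \<and> (\<Sum>x\<in>UNIV. m x) = 1 \<and>
     (\<forall>x y. m x * P x y = m y * P y x)"

definition laplacian :: "('v::finite \<Rightarrow> 'v \<Rightarrow> real) \<Rightarrow> ('v \<Rightarrow> real) \<Rightarrow> 'v \<Rightarrow> real" where
  "laplacian P f x = (\<Sum>y\<in>UNIV. P x y * (f y - f x))"

definition lipschitz1 :: "('v \<Rightarrow> 'v \<Rightarrow> real) \<Rightarrow> ('v \<Rightarrow> real) \<Rightarrow> bool" where
  "lipschitz1 d f \<longleftrightarrow> (\<forall>x y. \<bar>f x - f y\<bar> \<le> d x y)"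

definition ollivier_curvature ::
  "('v::finite \<Rightarrow> 'v \<Rightarrow> real) \<Rightarrow> ('v \<Rightarrow> 'v \<Rightarrow> real) \<Rightarrow> 'v \<Rightarrow> 'v \<Rightarrow> real" where
  "ollivier_curvature P d x y =
     Inf {(laplacian P f x - laplacian P f y) / d x y | f. lipschitz1 d f \<and> f y - f x = d x y}"

definition P0 :: "('v \<Rightarrow> 'v \<Rightarrow> real) \<Rightarrow> ('v \<Rightarrow> 'v \<Rightarrow> real) \<Rightarrow> real" where
  "P0 P d = Inf {P x y * (d x y)\<^sup>2 | x y. adj P x y}"

definition edge_boundary ::
  "('v::finite \<Rightarrow> 'v \<Rightarrow> real) \<Rightarrow> ('v \<Rightarrow> 'v \<Rightarrow> real) \<Rightarrow> ('v \<Rightarrow> real) \<Rightarrow> 'v set \<Rightarrow> real" where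
  "edge_boundary P d m W = (\<Sum>x\<in>W. \<Sum>y\<in>UNIV - W. P x y * m x * d x y)"

definition closure_nb :: "('v \<Rightarrow> 'v \<Rightarrow> real) \<Rightarrow> 'v set \<Rightarrow> 'v set" where
  "closure_nb P B = B \<union> {x. \<exists>y\<in>B. adj P x y}"

definition set_distance :: "('v \<Rightarrow> 'v \<Rightarrow> real) \<Rightarrow> 'v set \<Rightarrow> 'v set \<Rightarrow> real" where
  "set_distance d A B = Min {d a b | a b. a \<in> A \<and> b \<in> B}"

definition obs_diam ::
  "('v::finite \<Rightarrow> 'v \<Rightarrow> real) \<Rightarrow> ('v \<Rightarrow> 'v \<Rightarrow> real) \<Rightarrow> ('v \<Rightarrow> real) \<Rightarrow> real \<Rightarrow> real" where
  "obs_diam P d m \<epsilon> = Sup {set_distance d A B | A B.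
      sum m A \<ge> \<epsilon> \<and> sum m (closure_nb P B) \<ge> \<epsilon>}"

end

theory Submission
  imports Defs "HOL-Analysis.Analysis"
begin

text \<open>
  Non-negative curvature makes the lazy Markov operator preserve 1-Lipschitz functions. Apply it to
  such a function, restrict to the inner vertex boundary of \<open>W\<close>, and extend back minimally into \<open>W\<close>
  and maximally outside. Brouwer gives a fixed point \<open>f\<close> of this map up to an additive constant;
  it satisfies \<open>\<Delta>f \<ge> C\<close> on \<open>W\<close> and \<open>\<Delta>f \<le> C\<close> off \<open>W\<close>, and outside \<open>W\<close> it decreases at unit speed
  along some edge.
  Testing \<open>\<Delta>f\<close> against \<open>\<psi> = exp (- \<alpha> max 0 (f - s))\<close>, the sign pattern bounds \<open>\<Sum>m \<psi> \<Delta>f\<close> above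
  by \<open>\<bar>\<partial>W\<bar> + C (\<Sum>m \<psi> - m(W))\<close>, while the descending edges bound it below by \<open>\<alpha> P\<^sub>0 \<Sum>m \<psi>\<close>, summed over
  the vertices outside \<open>W\<close> whose neighbours all satisfy \<open>f \<ge> s\<close>. With \<open>s\<close> an
  \<open>\<epsilon>\<close>-quantile of \<open>f\<close>, sublevel sets being weighed through their closures, \<open>f \<le> s + diam\<^sub>o\<^sub>b\<^sub>s\<close> except on mass \<open>\<epsilon>\<close>, and
  \<open>\<alpha> = 2/3 log(1/\<epsilon>) / diam\<^sub>o\<^sub>b\<^sub>s\<close> gives the estimate.
\<close>

section \<open>Continuity of finite minima and maxima\<close>

lemma continuous_on_Min_image:
  fixes g :: "'k \<Rightarrow> 'a::topological_space \<Rightarrow> real"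
  assumes "finite K" "K \<noteq> {}" "\<And>k. k \<in> K \<Longrightarrow> continuous_on S (g k)"
  shows "continuous_on S (\<lambda>x. Min ((\<lambda>k. g k x) ` K))"
  using assms
proof (induction K rule: finite_ne_induct)
  case (insert k F)
  then have "(\<lambda>x. Min ((\<lambda>k. g k x) ` insert k F)) = (\<lambda>x. min (g k x) (Min ((\<lambda>k. g k x) ` F)))"
    by simp
  with insert show ?case by (simp add: continuous_on_min)
qed simp

lemma continuous_on_Max_image:
  fixes g :: "'k \<Rightarrow> 'a::topological_space \<Rightarrow> real"
  assumes "finite K" "K \<noteq> {}" "\<And>k. k \<in> K \<Longrightarrow> continuous_on S (g k)"
  shows "continuous_on S (\<lambda>x. Max ((\<lambda>k. g k x) ` K))"
  using assms
proof (induction K rule: finite_ne_induct)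
  case (insert k F)
  then have "(\<lambda>x. Max ((\<lambda>k. g k x) ` insert k F)) = (\<lambda>x. max (g k x) (Max ((\<lambda>k. g k x) ` F)))"
    by simp
  with insert show ?case by (simp add: continuous_on_max)
qed simp

section \<open>Paths and their lengths\<close>

lemma graph_paths_Cons:
  "x # xs \<in> graph_paths P x y \<longleftrightarrow>
     (xs = [] \<and> x = y) \<or> (xs \<noteq> [] \<and> adj P x (hd xs) \<and> xs \<in> graph_paths P (hd xs) y)"
proof (cases xs)
  case (Cons z zs)
  have split: "(\<forall>i. Q i) \<longleftrightarrow> Q 0 \<and> (\<forall>i. Q (Suc i))" for Q
    by (metis not0_implies_Suc)
  have "(\<forall>i. Suc i < length (x # xs) \<longrightarrow> adj P ((x # xs) ! i) ((x # xs) ! Suc i)) \<longleftrightarrow>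
      adj P x (hd xs) \<and> (\<forall>i. Suc i < length xs \<longrightarrow> adj P (xs ! i) (xs ! Suc i))"
    using Cons by (subst split) auto
  then show ?thesis using Cons by (auto simp: graph_paths_def)
qed (auto simp: graph_paths_def)

lemma path_length_Cons:
  "xs \<noteq> [] \<Longrightarrow> path_length d (x # xs) = d x (hd xs) + path_length d xs"
proof (cases xs)
  case (Cons z zs)
  then show ?thesis
    unfolding path_length_def by (simp add: sum.lessThan_Suc_shift del: sum.lessThan_Suc)
qed simp

lemma graph_paths_append:
  "p \<in> graph_paths P x z \<Longrightarrow> q \<in> graph_paths P z y \<Longrightarrow>
    \<exists>r\<in>graph_paths P x y. path_length d r = path_length d p + path_length d q"
proof (induction p arbitrary: x)
  case Nil
  then show ?case by (simp add: graph_paths_def)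
next
  case (Cons a p)
  from Cons.prems have a: "a = x" by (simp add: graph_paths_def)
  show ?case
  proof (cases "p = []")
    case True
    with Cons.prems have "x = z" by (auto simp: graph_paths_def)
    with True Cons.prems show ?thesis by (auto simp: path_length_def)
  next
    case False
    with Cons.prems a have p: "adj P x (hd p)" "p \<in> graph_paths P (hd p) z"
      by (simp_all add: graph_paths_Cons)
    from Cons.IH[OF p(2) Cons.prems(2)] obtain r where
      r: "r \<in> graph_paths P (hd p) y" "path_length d r = path_length d p + path_length d q" by blast
    then have "r \<noteq> []" "hd r = hd p" by (auto simp: graph_paths_def)
    with r p False a show ?thesis
      by (intro bexI[of _ "x # r"]) (auto simp: graph_paths_Cons path_length_Cons)
  qed
qed

section \<open>The path metric of a Markov chain\<close>

locale metric_chain =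
  fixes P d :: "'v::finite \<Rightarrow> 'v \<Rightarrow> real"
  assumes kernel: "markov_kernel P"
    and path_dist: "path_distance P d"
begin

lemma P_nonneg [simp]: "0 \<le> P x y"
  using kernel by (simp add: markov_kernel_def)

lemma P_sum [simp]: "(\<Sum>y\<in>UNIV. P x y) = 1"
  using kernel by (simp add: markov_kernel_def)

lemma dist_sym: "d x y = d y x"
  using path_dist unfolding path_distance_def by blast

lemma dist_pos: "x \<noteq> y \<Longrightarrow> 0 < d x y"
  using path_dist unfolding path_distance_def by blast

lemma graph_paths_nonempty: "graph_paths P x y \<noteq> {}"
  using path_dist unfolding path_distance_def by blast

lemma dist_Inf: "d x y = (INF xs\<in>graph_paths P x y. path_length d xs)"
  using path_dist unfolding path_distance_def by blast

lemma path_length_nonneg: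
  "xs \<in> graph_paths P x y \<Longrightarrow> 0 \<le> path_length d xs"
  unfolding path_length_def graph_paths_def
  by (intro sum_nonneg) (auto simp: adj_def intro!: less_imp_le dist_pos)

lemma dist_le_path_length:
  assumes "xs \<in> graph_paths P x y"
  shows "d x y \<le> path_length d xs"
  by (subst dist_Inf, rule cINF_lower[OF _ assms])
    (auto intro!: bdd_belowI[of _ 0] path_length_nonneg)

text \<open>Concatenated paths compete in the infimum for \<open>d x y\<close>. The infimum is taken
  over the first leg with the second leg fixed, and only then over the second.\<close>

lemma dist_triangle: "d x y \<le> d x z + d z y"
proof -
  have le: "d x y - path_length d q \<le> d x z" if q: "q \<in> graph_paths P z y" for q
    unfolding dist_Inf[of x z]
  proof (rule cINF_greatest[OF graph_paths_nonempty])
    fix p assume "p \<in> graph_paths P x z"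
    from graph_paths_append[OF this q] obtain r where
      "r \<in> graph_paths P x y" "path_length d r = path_length d p + path_length d q" by blast
    with dist_le_path_length[of r x y] show "d x y - path_length d q \<le> path_length d p" by linarith
  qed
  have "d x y - d x z \<le> path_length d q" if "q \<in> graph_paths P z y" for q
    using le[OF that] by linarith
  then have "d x y - d x z \<le> d z y"
    unfolding dist_Inf[of z y] by (intro cINF_greatest[OF graph_paths_nonempty]) auto
  then show ?thesis by simp
qed

lemma dist_self [simp]: "d x x = 0"
proof -
  have "[x] \<in> graph_paths P x x" by (simp add: graph_paths_Cons)
  from dist_le_path_length[OF this] have "d x x \<le> 0" by (simp add: path_length_def)
  with dist_triangle[of x x x] show ?thesis by simp
qed

lemma dist_nonneg [simp]: "0 \<le> d x y"
  using dist_pos[of x y] by (cases "x = y") auto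

text \<open>Infinitely many paths may compete in the infimum, but they have only finitely many first
  steps, so a best first step exists without exhibiting a shortest path.\<close>

lemma geodesic_neighbour:
  assumes "x \<noteq> y"
  obtains z where "adj P x z" "d x y = d x z + d z y"
proof -
  let ?N = "{z. adj P x z}"
  have first: "\<exists>z. adj P x z \<and> d x z + d z y \<le> path_length d xs"
    if "xs \<in> graph_paths P x y" for xs
  proof -
    from that assms obtain r where r: "xs = x # r" "r \<noteq> []"
      by (cases xs) (auto simp: graph_paths_def split: if_splits)
    with that have "adj P x (hd r)" "r \<in> graph_paths P (hd r) y" by (auto simp: graph_paths_Cons)
    then show ?thesis using dist_le_path_length r by (force simp: path_length_Cons)
  qed
  with graph_paths_nonempty have ne: "?N \<noteq> {}" by blast
  define M where "M = Min ((\<lambda>z. d x z + d z y) ` ?N)"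
  have "M \<le> d x y"
    unfolding dist_Inf[of x y]
  proof (rule cINF_greatest[OF graph_paths_nonempty])
    fix xs assume "xs \<in> graph_paths P x y"
    from first[OF this] obtain z where "adj P x z" "d x z + d z y \<le> path_length d xs" by blast
    moreover from this have "M \<le> d x z + d z y" unfolding M_def by (intro Min_le) auto
    ultimately show "M \<le> path_length d xs" by linarith
  qed
  moreover have "M \<in> (\<lambda>z. d x z + d z y) ` ?N" unfolding M_def using ne by (intro Min_in) auto
  ultimately show thesis using that dist_triangle by (force intro: antisym)
qed

lemma P0_le: "adj P x y \<Longrightarrow> P0 P d \<le> P x y * (d x y)\<^sup>2"
  unfolding P0_def by (rule cInf_lower) (auto intro!: bdd_belowI[of _ 0])

section \<open>Lipschitz functions, the Laplacian and geodesics leaving a set\<close>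

lemma lipschitz1D: "lipschitz1 d f \<Longrightarrow> f x - f y \<le> d x y"
  unfolding lipschitz1_def by (metis abs_le_D1)

lemma lipschitz1I: "(\<And>x y. f x - f y \<le> d x y) \<Longrightarrow> lipschitz1 d f"
  unfolding lipschitz1_def by (metis abs_le_iff dist_sym minus_diff_eq)

lemma laplacian_alt: "laplacian P f x = (\<Sum>y\<in>UNIV. P x y * f y) - f x"
proof -
  have "laplacian P f x = (\<Sum>y\<in>UNIV. P x y * f y) - (\<Sum>y\<in>UNIV. P x y) * f x"
    by (simp only: laplacian_def right_diff_distrib sum_subtractf sum_distrib_right)
  then show ?thesis by simp
qed

lemma laplacian_bound:
  assumes "lipschitz1 d f"
  shows "\<bar>laplacian P f x\<bar> \<le> (\<Sum>y\<in>UNIV. P x y * d x y)"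
proof -
  have "\<bar>laplacian P f x\<bar> \<le> (\<Sum>y\<in>UNIV. \<bar>P x y * (f y - f x)\<bar>)"
    unfolding laplacian_def by (rule sum_abs)
  also have "\<dots> \<le> (\<Sum>y\<in>UNIV. P x y * d x y)"
  proof (rule sum_mono)
    fix y
    have "\<bar>f y - f x\<bar> \<le> d x y" using assms dist_sym[of x y] by (simp add: lipschitz1_def)
    then show "\<bar>P x y * (f y - f x)\<bar> \<le> P x y * d x y" by (simp add: abs_mult mult_left_mono)
  qed
  finally show ?thesis .
qed

lemma laplacian_antimono_adj:
  assumes "adj P x y" "0 \<le> ollivier_curvature P d x y" "lipschitz1 d f" "f y - f x = d x y"
  shows "laplacian P f y \<le> laplacian P f x"
proof -
  let ?S = "{(laplacian P f x - laplacian P f y) / d x y | f. lipschitz1 d f \<and> f y - f x = d x y}"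
  let ?b = "\<lambda>x. \<Sum>z\<in>UNIV. P x z * d x z"
  have pos: "0 < d x y" using assms(1) by (auto simp: adj_def intro: dist_pos)
  \<comment> \<open>A real \<open>Inf\<close> is a lower bound only of a set that is bounded below;
    the uniform bound on Laplacians of 1-Lipschitz functions provides this.\<close>
  have "bdd_below ?S"
  proof (rule bdd_belowI[of _ "- (?b x + ?b y) / d x y"])
    fix v assume "v \<in> ?S"
    then obtain g where g: "lipschitz1 d g" "v = (laplacian P g x - laplacian P g y) / d x y" by auto
    then have "- (?b x + ?b y) \<le> laplacian P g x - laplacian P g y"
      using laplacian_bound[OF g(1), of x] laplacian_bound[OF g(1), of y] by linarith
    with pos show "- (?b x + ?b y) / d x y \<le> v" unfolding g(2) by (intro divide_right_mono) auto
  qed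
  then have "Inf ?S \<le> (laplacian P f x - laplacian P f y) / d x y"
    using assms by (intro cInf_lower) auto
  with assms(2) have "0 \<le> (laplacian P f x - laplacian P f y) / d x y"
    unfolding ollivier_curvature_def by linarith
  with pos show ?thesis by (simp add: zero_le_divide_iff)
qed

text \<open>A geodesic from \<open>x\<close> to \<open>y\<close> must leave \<open>W\<close>, and
  \<open>k\<close> is the vertex just before its first exit. Distances are real, so the induction
  counts the vertices closer to \<open>y\<close> than the current one.\<close>

lemma inner_boundary_separates:
  assumes "x \<in> W" "y \<notin> W"
  shows "\<exists>k\<in>W. (\<exists>z. z \<notin> W \<and> adj P k z) \<and> d x y = d x k + d k y"
  using assms
proof (induction "card {u. d u y < d x y}" arbitrary: x rule: less_induct)
  case less
  then have "x \<noteq> y" by auto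
  then obtain z where z: "adj P x z" "d x y = d x z + d z y" by (rule geodesic_neighbour)
  show ?case
  proof (cases "z \<in> W")
    case False
    with z less.prems show ?thesis by (intro bexI[of _ x]) auto
  next
    case True
    have lt: "d z y < d x y" using z dist_pos[of x z] by (auto simp: adj_def)
    have "card {u. d u y < d z y} < card {u. d u y < d x y}"
      using lt by (intro psubset_card_mono) auto
    from less.hyps[OF this True less.prems(2)] obtain k where
      k: "k \<in> W" "\<exists>z. z \<notin> W \<and> adj P k z" "d z y = d z k + d k y" by blast
    have "d x y = d x k + d k y"
      using dist_triangle[of x k z] dist_triangle[of x y k] z k by linarith
    with k show ?thesis by blast
  qed
qed

end

section \<open>Consequences of non-negative curvature\<close>

locale nonneg_curved_chain = metric_chain P d for P d :: "'v::finite \<Rightarrow> 'v \<Rightarrow> real" +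
  assumes curvature: "\<And>x y. adj P x y \<Longrightarrow> 0 \<le> ollivier_curvature P d x y"
begin

text \<open>A 1-Lipschitz function that rises by the full distance from \<open>x\<close> to
  \<open>y\<close> rises at unit rate on every edge of a geodesic, so the edgewise inequality chains
  along it.\<close>

lemma laplacian_antimono:
  assumes "lipschitz1 d f" "f y - f x = d x y"
  shows "laplacian P f y \<le> laplacian P f x"
  using assms(2)
proof (induction "card {u. d u y < d x y}" arbitrary: x rule: less_induct)
  case less
  show ?case
  proof (cases "x = y")
    case False
    then obtain z where z: "adj P x z" "d x y = d x z + d z y" by (rule geodesic_neighbour)
    have lt: "d z y < d x y" using z dist_pos[of x z] by (auto simp: adj_def)
    have c: "card {u. d u y < d z y} < card {u. d u y < d x y}"
      using lt by (intro psubset_card_mono) auto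
    have eq: "f y - f z = d z y" "f z - f x = d x z"
      using lipschitz1D[OF assms(1), of y z] lipschitz1D[OF assms(1), of z x]
        less.prems z dist_sym[of z x] dist_sym[of y z] by linarith+
    from less.hyps[OF c eq(1)] laplacian_antimono_adj[OF z(1) curvature[OF z(1)] assms(1) eq(2)]
    show ?thesis by linarith
  qed simp
qed

text \<open>For a pair with slack \<eta>, the comparison function \<open>f'\<close> costs \<eta> in
  its value at \<open>y\<close> and at most \<eta> in the average at \<open>x\<close>. Hence the
  Laplacian difference is at most 2\<eta>, and half of it just fits into the slack; this is why the
  step is lazy.\<close>

lemma lazy_step_lipschitz:
  assumes "lipschitz1 d f"
  shows "lipschitz1 d (\<lambda>x. f x + laplacian P f x / 2)"
proof (rule lipschitz1I)
  fix y x
  define \<eta> where "\<eta> = d x y - (f y - f x)"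
  \<comment> \<open>raise \<open>f\<close> near \<open>y\<close> by at most the slack \<open>\<eta>\<close> so that the pair \<open>(x, y)\<close> becomes tight\<close>
  define f' where "f' = (\<lambda>z. max (f z) (f x + d x y - d z y))"
  have f'_x: "f' x = f x" and f'_y: "f' y = f y + \<eta>"
    using lipschitz1D[OF assms, of y x] dist_sym[of x y] by (auto simp: f'_def \<eta>_def)
  have f': "f z \<le> f' z" "f' z \<le> f z + \<eta>" for z
    using lipschitz1D[OF assms, of y x] lipschitz1D[OF assms, of y z] dist_sym[of x y] dist_sym[of z y]
    by (auto simp: f'_def \<eta>_def)
  have "lipschitz1 d f'"
  proof (rule lipschitz1I)
    fix u v
    show "f' u - f' v \<le> d u v"
      using lipschitz1D[OF assms, of u v] dist_triangle[of v y u] dist_sym[of u v]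
      by (auto simp: f'_def max_def)
  qed
  then have 1: "laplacian P f' y \<le> laplacian P f' x"
    by (rule laplacian_antimono) (simp add: f'_x f'_y \<eta>_def)
  have "(\<Sum>z\<in>UNIV. P y z * f z) \<le> (\<Sum>z\<in>UNIV. P y z * f' z)"
    by (intro sum_mono mult_left_mono f') auto
  moreover have "(\<Sum>z\<in>UNIV. P x z * f' z) \<le> (\<Sum>z\<in>UNIV. P x z * (f z + \<eta>))"
    by (intro sum_mono mult_left_mono f') auto
  moreover have "(\<Sum>z\<in>UNIV. P x z * (f z + \<eta>)) = (\<Sum>z\<in>UNIV. P x z * f z) + \<eta>"
    by (simp add: distrib_left sum.distrib flip: sum_distrib_right)
  ultimately have "laplacian P f y - laplacian P f x \<le> 2 * \<eta>"
    using 1 unfolding laplacian_alt f'_x f'_y by linarith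
  then show "f y + laplacian P f y / 2 - (f x + laplacian P f x / 2) \<le> d y x"
    using dist_sym[of x y] by (simp add: \<eta>_def)
qed

text \<open>At a fixed point, \<open>E (Q f) = f + c\<close>. Since \<open>Q f\<close> is itself a
  1-Lipschitz extension of its values on \<open>K\<close>, it lies above the least extension on
  \<open>W\<close> and below the greatest one off \<open>W\<close>. Comparing \<open>Q f\<close>
  with \<open>f + c\<close> gives the sign of the Laplacian relative to
  \<open>2 * c\<close>.\<close>

lemma laplacian_separation:
  assumes "W \<noteq> {}" "W \<noteq> UNIV"
  obtains f C where "lipschitz1 d f" "\<forall>x\<in>W. C \<le> laplacian P f x"
    "\<forall>x\<in>-W. laplacian P f x \<le> C"
    "\<forall>y\<in>-W. \<exists>z. adj P y z \<and> f z = f y - d y z"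
proof -
  define K where "K = {k \<in> W. \<exists>z. z \<notin> W \<and> adj P k z}"
  \<comment> \<open>Only the values of \<open>g\<close> on \<open>K\<close> enter:
    \<open>E g\<close> is the least 1-Lipschitz extension inside \<open>W\<close> and the greatest
    outside.\<close>
  define E where "E = (\<lambda>g x. if x \<in> W then Max ((\<lambda>k. g k - d x k) ` K)
                              else Min ((\<lambda>k. g k + d x k) ` K))"
  have sep: "\<exists>k\<in>K. d x y = d x k + d k y" if "x \<in> W" "y \<notin> W" for x y
    using inner_boundary_separates[OF that] by (auto simp: K_def)
  from assms obtain x0 y0 where "x0 \<in> W" "y0 \<notin> W" by blast
  with sep obtain k0 where k0: "k0 \<in> K" by blast
  then have ne: "K \<noteq> {}" by blast
  have E_in: "\<exists>k\<in>K. E g x = g k - d x k" if "x \<in> W" for g x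
  proof -
    have "E g x \<in> (\<lambda>k. g k - d x k) ` K" using that ne by (simp add: E_def Max_in)
    then show ?thesis by blast
  qed
  have E_out: "\<exists>k\<in>K. E g x = g k + d x k" if "x \<notin> W" for g x
  proof -
    have "E g x \<in> (\<lambda>k. g k + d x k) ` K" using that ne by (simp add: E_def Min_in)
    then show ?thesis by blast
  qed
  have E_ge: "g k - d x k \<le> E g x" if "x \<in> W" "k \<in> K" for g x k
    using that by (simp add: E_def)
  have E_le: "E g x \<le> g k + d x k" if "x \<notin> W" "k \<in> K" for g x k
    using that by (simp add: E_def)
  have E_K: "E g k = g k" if "lipschitz1 d g" "k \<in> K" for g k
  proof -
    have "k \<in> W" using that by (simp add: K_def)
    then obtain k' where "k' \<in> K" "E g k = g k' - d k k'" using E_in by blast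
    with lipschitz1D[OF that(1), of k' k] E_ge[OF \<open>k \<in> W\<close> that(2), of g] dist_sym[of k k']
    show ?thesis by simp
  qed
  have E_lip: "lipschitz1 d (E g)" if g: "lipschitz1 d g" for g
  proof (rule lipschitz1I)
    fix x y
    consider "x \<in> W" "y \<in> W" | "x \<in> W" "y \<notin> W" | "x \<notin> W" "y \<in> W" | "x \<notin> W" "y \<notin> W" by blast
    then show "E g x - E g y \<le> d x y"
    proof cases
      case 1
      with E_in obtain k where k: "k \<in> K" "E g x = g k - d x k" by blast
      with E_ge[OF 1(2) k(1), of g] dist_triangle[of y k x] dist_sym[of x y] show ?thesis by linarith
    next
      case 2
      with E_in obtain k where k: "k \<in> K" "E g x = g k - d x k" by blast
      from 2 E_out obtain l where l: "l \<in> K" "E g y = g l + d y l" by blast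
      from k l lipschitz1D[OF g, of k l] dist_triangle[of k l x] dist_triangle[of x l y]
        dist_sym[of x k] dist_sym[of y l] show ?thesis by linarith
    next
      case 3
      \<comment> \<open>Here a greatest extension is compared with a least one, so the bound needs
        one \<open>k\<close> lying on a geodesic between the two points.\<close>
      with sep obtain k where k: "k \<in> K" "d y x = d y k + d k x" by blast
      with E_le[OF 3(1) k(1), of g] E_ge[OF 3(2) k(1), of g] dist_sym[of x y] dist_sym[of x k]
      show ?thesis by linarith
    next
      case 4
      with E_out obtain k where k: "k \<in> K" "E g y = g k + d y k" by blast
      with E_le[OF 4(1) k(1), of g] dist_triangle[of x k y] show ?thesis by linarith
    qed
  qed
  define Q where "Q = (\<lambda>f x. f x + laplacian P f x / 2)"
  have Q_lip: "lipschitz1 d (Q f)" if "lipschitz1 d f" for f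
    using lazy_step_lipschitz[OF that] by (simp add: Q_def)
  \<comment> \<open>Fixing the value at \<open>k0\<close> removes additive constants, which makes
    the 1-Lipschitz functions a compact convex set. Subtracting \<open>Q f k0\<close>, which equals
    \<open>E (Q f) k0\<close>, keeps \<open>F\<close> inside it.\<close>
  define S where "S = {v :: real^'v. lipschitz1 d (($) v) \<and> v $ k0 = 0}"
  define F where "F = (\<lambda>v :: real^'v. \<chi> x. E (Q (($) v)) x - Q (($) v) k0)"
  have "\<exists>v\<in>S. F v = v"
  proof -
    have S_alt: "S = (\<Inter>x. \<Inter>y. {v. v $ x - v $ y \<le> d x y}) \<inter> {v. v $ k0 = 0}"
      by (auto simp: S_def dest: lipschitz1D intro!: lipschitz1I)
    have "bounded S"
      unfolding bounded_iff
    proof (intro exI ballI)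
      fix v assume v: "v \<in> S"
      have "norm v \<le> (\<Sum>x\<in>UNIV. \<bar>v $ x\<bar>)" by (rule norm_le_l1_cart)
      also have "\<dots> \<le> (\<Sum>x\<in>UNIV. d x k0)"
      proof (rule sum_mono)
        fix x
        from v have "\<bar>v $ x - v $ k0\<bar> \<le> d x k0" "v $ k0 = 0"
          unfolding S_def lipschitz1_def by blast+
        then show "\<bar>v $ x\<bar> \<le> d x k0" by simp
      qed
      finally show "norm v \<le> (\<Sum>x\<in>UNIV. d x k0)" .
    qed
    moreover have "closed S"
      unfolding S_alt
      by (intro closed_Int closed_INT ballI closed_Collect_le closed_Collect_eq continuous_intros)
    ultimately have "compact S" by (simp add: compact_eq_bounded_closed)
    moreover have "convex S"
    proof (rule convexI)
      fix v w :: "real^'v" and a b :: real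
      assume *: "v \<in> S" "w \<in> S" "0 \<le> a" "0 \<le> b" "a + b = 1"
      have "(a *\<^sub>R v + b *\<^sub>R w) $ x - (a *\<^sub>R v + b *\<^sub>R w) $ y \<le> d x y" for x y
      proof -
        from * have "v $ x - v $ y \<le> d x y" "w $ x - w $ y \<le> d x y" by (auto simp: S_alt)
        with * have "a * (v $ x - v $ y) + b * (w $ x - w $ y) \<le> a * d x y + b * d x y"
          by (intro add_mono mult_left_mono) auto
        also have "\<dots> = d x y" using * by (simp flip: distrib_right)
        finally show ?thesis by (simp add: algebra_simps)
      qed
      with * show "a *\<^sub>R v + b *\<^sub>R w \<in> S" by (auto simp: S_alt)
    qed
    moreover have "0 \<in> S" by (simp add: S_alt)
    moreover have "continuous_on S F"
    proof -
      have Q_cont: "continuous_on S (\<lambda>v. Q (($) v) x)" for x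
        unfolding Q_def laplacian_def by (intro continuous_intros) auto
      have "continuous_on S (\<lambda>v. E (Q (($) v)) x)" for x
        unfolding E_def using ne
        by (cases "x \<in> W")
          (auto intro!: continuous_on_Min_image continuous_on_Max_image continuous_intros Q_cont)
      with Q_cont show ?thesis
        unfolding F_def by (intro continuous_on_vec_lambda continuous_on_diff) auto
    qed
    moreover have "F ` S \<subseteq> S"
    proof
      fix w assume "w \<in> F ` S"
      then obtain v where v: "lipschitz1 d (($) v)" "w = F v" by (auto simp: S_def)
      have "w $ k0 = 0" using E_K[OF Q_lip[OF v(1)] k0] by (simp add: v F_def)
      moreover have "w $ x - w $ y \<le> d x y" for x y
        using lipschitz1D[OF E_lip[OF Q_lip[OF v(1)]], of x y] by (simp add: v F_def)
      ultimately show "w \<in> S" by (auto simp: S_alt)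
    qed
    ultimately obtain v where "v \<in> S" "F v = v" using brouwer[of S F] by blast
    then show ?thesis by blast
  qed
  then obtain v where v: "v \<in> S" "F v = v" by blast
  define f where "f = ($) v"
  define c where "c = Q f k0"
  have lip: "lipschitz1 d f" using v by (simp add: S_def f_def)
  have fE: "f x = E (Q f) x - c" for x
  proof -
    have "v $ x = E (Q f) x - c" by (subst v(2)[symmetric]) (simp add: F_def f_def c_def)
    then show ?thesis by (simp add: f_def)
  qed
  have Q_K: "Q f k = f k + c" if "k \<in> K" for k
    using E_K[OF Q_lip[OF lip] that] fE[of k] by simp
  have "2 * c \<le> laplacian P f x" if x: "x \<in> W" for x
  proof -
    from E_in[OF x] obtain k where k: "k \<in> K" "E (Q f) x = Q f k - d x k" by blast
    with fE[of x] lipschitz1D[OF Q_lip[OF lip], of k x] dist_sym[of k x]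
    have "f x + c \<le> Q f x" by simp
    then show ?thesis by (simp add: Q_def)
  qed
  moreover have "laplacian P f x \<le> 2 * c" if x: "x \<notin> W" for x
  proof -
    from E_out[OF x] obtain k where k: "k \<in> K" "E (Q f) x = Q f k + d x k" by blast
    with fE[of x] lipschitz1D[OF Q_lip[OF lip], of x k]
    have "Q f x \<le> f x + c" by simp
    then show ?thesis by (simp add: Q_def)
  qed
  \<comment> \<open>Outside \<open>W\<close> the fixed point has the form
    \<open>f k + d y k\<close>, so it falls at unit rate along a geodesic from \<open>y\<close> to
    \<open>k\<close>.\<close>
  moreover have "\<exists>z. adj P y z \<and> f z = f y - d y z" if y: "y \<notin> W" for y
  proof -
    from E_out[OF y] obtain k where k: "k \<in> K" "E (Q f) y = Q f k + d y k" by blast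
    with fE[of y] Q_K[of k] have fy: "f y = f k + d y k" by simp
    have "y \<noteq> k" using k y by (auto simp: K_def)
    then obtain z where z: "adj P y z" "d y k = d y z + d z k" by (rule geodesic_neighbour)
    have "f z = f y - d y z"
      using lipschitz1D[OF lip, of z k] lipschitz1D[OF lip, of y z] fy z by linarith
    with z show ?thesis by blast
  qed
  ultimately show thesis by (intro that[OF lip, of "2 * c"]) auto
qed

end

section \<open>Reversibility and boundary flux\<close>

locale reversible_chain = metric_chain P d for P d :: "'v::finite \<Rightarrow> 'v \<Rightarrow> real" +
  fixes m :: "'v \<Rightarrow> real"
  assumes reversible: "reversible_measure P m"
begin

lemma m_nonneg [simp]: "0 \<le> m x"
  using reversible by (simp add: reversible_measure_def)

lemma m_UNIV [simp]: "sum m UNIV = 1"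
  using reversible by (simp add: reversible_measure_def)

lemma detailed_balance: "m x * P x y = m y * P y x"
  using reversible by (simp add: reversible_measure_def)

lemma sum_Un_le: "sum m (A \<union> B) \<le> sum m A + sum m B"
  using sum.union_inter[of A B m] sum_nonneg[of "A \<inter> B" m] by simp

lemma green_formula:
  "(\<Sum>x\<in>UNIV. m x * \<phi> x * laplacian P h x) =
     (\<Sum>x\<in>UNIV. \<Sum>z\<in>UNIV. m x * P x z * ((\<phi> x - \<phi> z) * (h z - h x))) / 2"
proof -
  let ?A = "\<Sum>x\<in>UNIV. m x * \<phi> x * laplacian P h x"
  have 1: "?A = (\<Sum>x\<in>UNIV. \<Sum>z\<in>UNIV. m x * P x z * (\<phi> x * (h z - h x)))"
    unfolding laplacian_def by (simp add: sum_distrib_left mult_ac)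
  also have "\<dots> = (\<Sum>x\<in>UNIV. \<Sum>z\<in>UNIV. m z * P z x * (\<phi> z * (h x - h z)))"
    by (rule sum.swap)
  also have "\<dots> = (\<Sum>x\<in>UNIV. \<Sum>z\<in>UNIV. m x * P x z * (\<phi> z * (h x - h z)))"
    by (subst detailed_balance) (rule refl)
  finally have 2: "?A = (\<Sum>x\<in>UNIV. \<Sum>z\<in>UNIV. m x * P x z * (\<phi> z * (h x - h z)))" .
  have "?A + ?A = (\<Sum>x\<in>UNIV. \<Sum>z\<in>UNIV.
      m x * P x z * (\<phi> x * (h z - h x)) + m x * P x z * (\<phi> z * (h x - h z)))"
    unfolding sum.distrib by (rule arg_cong2[OF 1 2, of "(+)"])
  also have "\<dots> = (\<Sum>x\<in>UNIV. \<Sum>z\<in>UNIV. m x * P x z * ((\<phi> x - \<phi> z) * (h z - h x)))"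
    by (intro sum.cong refl) (simp add: algebra_simps)
  finally show ?thesis by simp
qed

text \<open>Contributions of pairs inside \<open>W\<close> cancel by detailed balance; each
  remaining pair crosses the boundary, with increment at most its length.\<close>

lemma laplacian_mass_le_boundary:
  assumes "lipschitz1 d f"
  shows "\<bar>\<Sum>x\<in>W. m x * laplacian P f x\<bar> \<le> edge_boundary P d m W"
proof -
  let ?I = "\<Sum>x\<in>W. \<Sum>y\<in>W. m x * P x y * (f y - f x)"
  have "?I = (\<Sum>x\<in>W. \<Sum>y\<in>W. m y * P y x * (f x - f y))"
    by (rule sum.swap)
  also have "\<dots> = - ?I"
    unfolding sum_negf[symmetric]
    by (intro sum.cong refl, subst detailed_balance) (simp add: algebra_simps)
  finally have "?I = 0" by simp
  have "(\<Sum>x\<in>W. m x * laplacian P f x) = (\<Sum>x\<in>W. \<Sum>y\<in>UNIV. m x * P x y * (f y - f x))"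
    unfolding laplacian_def by (simp add: sum_distrib_left mult_ac)
  also have "\<dots> = (\<Sum>x\<in>W. (\<Sum>y\<in>UNIV - W. m x * P x y * (f y - f x)) + (\<Sum>y\<in>W. m x * P x y * (f y - f x)))"
    by (intro sum.cong refl sum.subset_diff) auto
  also have "\<dots> = (\<Sum>x\<in>W. \<Sum>y\<in>UNIV - W. m x * P x y * (f y - f x))"
    using \<open>?I = 0\<close> by (simp add: sum.distrib)
  also have "\<bar>\<dots>\<bar> \<le> (\<Sum>x\<in>W. \<Sum>y\<in>UNIV - W. \<bar>m x * P x y * (f y - f x)\<bar>)"
    by (intro order_trans[OF sum_abs] sum_mono sum_abs)
  also have "\<dots> \<le> edge_boundary P d m W"
    unfolding edge_boundary_def
  proof (intro sum_mono)
    fix x y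
    have "\<bar>f y - f x\<bar> \<le> d x y" using assms dist_sym[of x y] by (simp add: lipschitz1_def)
    then have "m x * P x y * \<bar>f y - f x\<bar> \<le> m x * P x y * d x y" by (intro mult_left_mono) auto
    then show "\<bar>m x * P x y * (f y - f x)\<bar> \<le> P x y * m x * d x y" by (simp add: abs_mult mult_ac)
  qed
  finally show ?thesis .
qed

lemma edge_boundary_nonneg: "0 \<le> edge_boundary P d m W"
  unfolding edge_boundary_def by (intro sum_nonneg) auto

section \<open>Observable diameter and level sets\<close>

lemma set_distance_le_obs_diam:
  assumes "\<epsilon> \<le> sum m A" "\<epsilon> \<le> sum m (closure_nb P B)"
  shows "set_distance d A B \<le> obs_diam P d m \<epsilon>"
  unfolding obs_diam_def
proof (rule cSup_upper)
  show "bdd_above {set_distance d A B |A B. sum m A \<ge> \<epsilon> \<and> sum m (closure_nb P B) \<ge> \<epsilon>}"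
    by (intro bdd_above_finite finite_image_set2) simp_all
qed (use assms in auto)

lemma obs_diam_nonneg:
  assumes "\<epsilon> \<le> 1"
  shows "0 \<le> obs_diam P d m \<epsilon>"
proof -
  have "closure_nb P UNIV = UNIV" by (simp add: closure_nb_def)
  then have "set_distance d UNIV UNIV \<le> obs_diam P d m \<epsilon>"
    using assms by (intro set_distance_le_obs_diam) auto
  moreover have "finite {d a b | a b. a \<in> UNIV \<and> b \<in> UNIV}" by (intro finite_image_set2) simp_all
  then have "0 \<le> set_distance d UNIV UNIV"
    unfolding set_distance_def by (intro Min.boundedI) auto
  ultimately show ?thesis by simp
qed

text \<open>Take \<open>s\<close> as the least value of \<open>f\<close> whose weak sublevel set has
  closure of mass at least \<epsilon>. A superlevel set of mass \<epsilon> beyond \<open>s\<close>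
  plus the observable diameter would then be too far from that sublevel set.\<close>

lemma obs_diam_level_sets:
  assumes "0 < \<epsilon>" "\<epsilon> \<le> 1" "lipschitz1 d f"
  obtains s where "sum m (closure_nb P {x. f x < s}) < \<epsilon>"
    "sum m {x. s + obs_diam P d m \<epsilon> < f x} < \<epsilon>"
proof -
  define T where "T = {t \<in> range f. \<epsilon> \<le> sum m (closure_nb P {x. f x \<le> t})}"
  define s where "s = Min T"
  have "finite T" by (simp add: T_def)
  have "{x. f x \<le> Max (range f)} = UNIV" by auto
  with assms have "Max (range f) \<in> T" by (simp add: T_def closure_nb_def)
  with \<open>finite T\<close> have "s \<in> T" unfolding s_def by (intro Min_in) auto
  have "sum m (closure_nb P {x. f x < s}) < \<epsilon>"
  proof (cases "{x. f x < s} = {}")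
    case True
    with assms show ?thesis by (simp add: closure_nb_def)
  next
    case False
    \<comment> \<open>The largest value of \<open>f\<close> below \<open>s\<close> turns the strict
      sublevel set into a weak one at an attained level, where minimality of \<open>s\<close>
      applies.\<close>
    define t where "t = Max (f ` {x. f x < s})"
    have "t \<in> f ` {x. f x < s}" unfolding t_def using False by (intro Max_in) auto
    then have t: "t \<in> range f" "t < s" by auto
    moreover have "f x \<le> t" if "f x < s" for x
      unfolding t_def using that by (intro Max_ge) auto
    ultimately have "{x. f x < s} = {x. f x \<le> t}" by force
    moreover have "t \<notin> T" using \<open>finite T\<close> t(2) by (auto simp: s_def dest: Min_le)
    ultimately show ?thesis using t(1) by (simp add: T_def not_le)
  qed
  moreover have "sum m {x. s + obs_diam P d m \<epsilon> < f x} < \<epsilon>"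
  proof (rule ccontr)
    let ?A = "{x. s + obs_diam P d m \<epsilon> < f x}" and ?B = "{x. f x \<le> s}"
    let ?D = "{d a b | a b. a \<in> ?A \<and> b \<in> ?B}"
    assume "\<not> sum m ?A < \<epsilon>"
    then have A: "\<epsilon> \<le> sum m ?A" by simp
    moreover from \<open>s \<in> T\<close> have B: "\<epsilon> \<le> sum m (closure_nb P ?B)" by (simp add: T_def)
    ultimately have le: "set_distance d ?A ?B \<le> obs_diam P d m \<epsilon>" by (rule set_distance_le_obs_diam)
    \<comment> \<open>Non-emptiness, a consequence of \<epsilon> > 0, ensures that the
      \<open>Min\<close> in \<open>set_distance\<close> is attained.\<close>
    have "?A \<noteq> {}" using A assms(1) by (metis leD sum.empty)
    moreover have "?B \<noteq> {}" using B assms(1) by (force simp: closure_nb_def)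
    ultimately have "?D \<noteq> {}" by blast
    moreover have "finite ?D" by (intro finite_image_set2) simp_all
    ultimately have "set_distance d ?A ?B \<in> ?D" unfolding set_distance_def by (rule Min_in[rotated])
    then obtain a b where "a \<in> ?A" "b \<in> ?B" "set_distance d ?A ?B = d a b" by blast
    with lipschitz1D[OF assms(3), of a b] le show False by simp
  qed
  ultimately show thesis by (rule that)
qed

text \<open>As \<psi> decreases in \<open>f\<close>, every term of Green's formula is non-negative,
  so one descending edge per vertex of \<open>G\<close> may be kept. The condition
  \<open>s \<le> f z\<close> keeps the truncation inactive on that edge, so \<psi> grows there by
  the factor \<open>exp (\<alpha> * d y z)\<close>.\<close>

lemma energy_lower_bound:
  assumes "lipschitz1 d f" "0 \<le> \<alpha>"
    and \<psi>: "\<psi> = (\<lambda>x. exp (- \<alpha> * max 0 (f x - s)))"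
    and G: "\<And>y. y \<in> G \<Longrightarrow> \<exists>z. adj P y z \<and> f z = f y - d y z \<and> s \<le> f z"
  shows "\<alpha> * P0 P d * (\<Sum>y\<in>G. m y * \<psi> y) \<le> (\<Sum>x\<in>UNIV. m x * \<psi> x * laplacian P f x)"
proof -
  define a where "a = (\<lambda>x z. m x * P x z * ((\<psi> x - \<psi> z) * (f z - f x)))"
  have a_sym: "a x z = a z x" for x z
    unfolding a_def detailed_balance[of x z] by (simp add: algebra_simps)
  have mono: "\<psi> z \<le> \<psi> x" if "f x \<le> f z" for x z
    using that assms(2) by (auto simp: \<psi> intro!: mult_left_mono)
  have a_nonneg: "0 \<le> a x z" for x z
  proof -
    have "0 \<le> (\<psi> x - \<psi> z) * (f z - f x)"
      using mono[of x z] mono[of z x] by (cases "f x \<le> f z") (auto simp: zero_le_mult_iff)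
    then show ?thesis unfolding a_def by (rule mult_nonneg_nonneg[rotated]) simp
  qed
  \<comment> \<open>Charging each edge to its upper endpoint absorbs the factor 1/2 of Green's formula.\<close>
  define b where "b = (\<lambda>x z. if f z < f x then a x z else 0)"
  have b_nonneg: "0 \<le> b x z" for x z using a_nonneg by (simp add: b_def)
  have ab: "a x z = b x z + b z x" for x z
    using a_sym[of x z] by (auto simp: b_def) (auto simp: a_def)
  have "(\<Sum>x\<in>UNIV. m x * \<psi> x * laplacian P f x) = (\<Sum>x\<in>UNIV. \<Sum>z\<in>UNIV. a x z) / 2"
    unfolding a_def by (rule green_formula)
  also have "(\<Sum>x\<in>UNIV. \<Sum>z\<in>UNIV. a x z) =
      (\<Sum>x\<in>UNIV. \<Sum>z\<in>UNIV. b x z) + (\<Sum>x\<in>UNIV. \<Sum>z\<in>UNIV. b z x)"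
    by (simp add: ab sum.distrib)
  also have "(\<Sum>x\<in>UNIV. \<Sum>z\<in>UNIV. b z x) = (\<Sum>x\<in>UNIV. \<Sum>z\<in>UNIV. b x z)"
    by (rule sum.swap)
  finally have E: "(\<Sum>x\<in>UNIV. m x * \<psi> x * laplacian P f x) = (\<Sum>x\<in>UNIV. \<Sum>z\<in>UNIV. b x z)"
    by simp
  have "\<alpha> * P0 P d * (\<Sum>y\<in>G. m y * \<psi> y) = (\<Sum>y\<in>G. m y * (\<alpha> * \<psi> y * P0 P d))"
    by (simp add: sum_distrib_left mult_ac)
  also have "\<dots> \<le> (\<Sum>y\<in>G. \<Sum>z\<in>UNIV. b y z)"
  proof (rule sum_mono)
    fix y assume "y \<in> G"
    from G[OF this] obtain z where z: "adj P y z" "f z = f y - d y z" "s \<le> f z" by blast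
    have \<delta>: "0 < d y z" using z(1) by (auto simp: adj_def intro: dist_pos)
    have "max 0 (f y - s) = max 0 (f z - s) + d y z" using z(2,3) \<delta> by simp
    then have "\<psi> z = \<psi> y * exp (\<alpha> * d y z)"
      by (simp add: \<psi> algebra_simps flip: exp_add)
    moreover have "\<psi> y * (1 + \<alpha> * d y z) \<le> \<psi> y * exp (\<alpha> * d y z)"
      by (intro mult_left_mono exp_ge_add_one_self) (auto simp: \<psi>)
    ultimately have \<psi>_diff: "\<alpha> * \<psi> y * d y z \<le> \<psi> z - \<psi> y" by (simp add: algebra_simps)
    have "\<alpha> * \<psi> y * P0 P d \<le> \<alpha> * \<psi> y * (P y z * (d y z)\<^sup>2)"
      using assms(2) by (intro mult_left_mono P0_le[OF z(1)]) (auto simp: \<psi>)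
    also have "\<dots> = P y z * d y z * (\<alpha> * \<psi> y * d y z)" by (simp add: power2_eq_square)
    also have "\<dots> \<le> P y z * d y z * (\<psi> z - \<psi> y)"
      by (intro mult_left_mono \<psi>_diff) auto
    finally have "m y * (\<alpha> * \<psi> y * P0 P d) \<le> m y * (P y z * d y z * (\<psi> z - \<psi> y))"
      by (rule mult_left_mono) simp
    also have "\<dots> = m y * P y z * ((\<psi> y - \<psi> z) * (- d y z))" by (simp add: algebra_simps)
    also have "\<dots> = b y z" using z(2) \<delta> by (simp add: b_def a_def)
    also have "\<dots> \<le> (\<Sum>z\<in>UNIV. b y z)" by (rule member_le_sum) (auto simp: b_nonneg)
    finally show "m y * (\<alpha> * \<psi> y * P0 P d) \<le> (\<Sum>z\<in>UNIV. b y z)" .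
  qed
  also have "\<dots> \<le> (\<Sum>y\<in>UNIV. \<Sum>z\<in>UNIV. b y z)"
    by (intro sum_mono2) (auto intro!: sum_nonneg b_nonneg)
  finally show ?thesis unfolding E .
qed

end

text \<open>Here \<open>w\<close> is the mass of \<open>W\<close>, \<open>S\<close> and
  \<open>T\<close> are the \<psi>-masses of \<open>G\<close> and of the whole space, and
  \<open>R\<close> is \<open>P0 P d * ln (1/\<epsilon>)\<close> over the observable diameter. The
  sign of \<open>C\<close> decides which of the two flux bounds controls
  \<open>C * (T - w)\<close>.\<close>

lemma isoperimetric_arithmetic:
  fixes w \<epsilon> S T B C R :: real
  assumes w: "0 < w" "w \<le> 1/2" and \<epsilon>: "0 < \<epsilon>" "\<epsilon> \<le> 1/8"
    and B: "C * w \<le> B" "- C * (1 - w) \<le> B"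
    and S: "2 * \<epsilon> * (1 - w - 2 * \<epsilon>) \<le> S" and T: "S \<le> T" "T \<le> S + w + \<epsilon>"
    and main: "2/3 * R * S \<le> B + C * (T - w)"
    and R: "0 \<le> R"
  shows "R * min w \<epsilon> / 6 \<le> B"
proof (rule ccontr)
  assume "\<not> ?thesis"
  then have lt: "B < R * min w \<epsilon> / 6" by simp
  have "0 \<le> B"
  proof (cases "0 \<le> C")
    case True
    with w have "0 \<le> C * w" by simp
    with B(1) show ?thesis by linarith
  next
    case False
    with w have "0 \<le> - C * (1 - w)" by (intro mult_nonneg_nonneg) auto
    with B(2) show ?thesis by linarith
  qed
  have "R \<noteq> 0" using lt \<open>0 \<le> B\<close> by auto
  with R have "0 < R" by simp
  have "2 * \<epsilon> * (1/4) \<le> 2 * \<epsilon> * (1 - w - 2 * \<epsilon>)" using w \<epsilon> by (intro mult_left_mono) auto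
  with S have S': "\<epsilon> / 2 \<le> S" by simp
  show False
  proof (cases "0 \<le> C")
    case False
    have "C * (T - w) \<le> - C * w"
      using False S' T \<epsilon> by (simp add: algebra_simps mult_nonpos_nonneg)
    also have "\<dots> \<le> - C * (1 - w)" using False w by (intro mult_left_mono) auto
    finally have "2/3 * R * S \<le> 2 * B" using B(2) main by linarith
    also have "2 * B < R * min w \<epsilon> / 3" using lt by simp
    also have "\<dots> \<le> R * \<epsilon> / 3" using \<open>0 < R\<close> by simp
    finally have "R * (2 * S) < R * \<epsilon>" by simp
    with \<open>0 < R\<close> S' show False by simp
  next
    case True
    have "C \<le> B / w" using B(1) w by (simp add: field_simps)
    have "C * (T - w) \<le> C * (S + \<epsilon>)" using True T by (intro mult_left_mono) auto
    also have "\<dots> \<le> B / w * (S + \<epsilon>)" using \<open>C \<le> B / w\<close> S' \<epsilon> by (intro mult_right_mono) auto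
    finally have "2/3 * R * S \<le> B + B / w * (S + \<epsilon>)" using main by linarith
    also have "\<dots> = B * ((w + S + \<epsilon>) / w)" using w by (simp add: field_simps)
    also have "\<dots> < R * min w \<epsilon> / 6 * ((w + S + \<epsilon>) / w)"
      using lt w \<epsilon> S' by (intro mult_strict_right_mono) auto
    finally have "R * (4 * w * S) < R * (min w \<epsilon> * (w + S + \<epsilon>))" using w by (simp add: field_simps)
    with \<open>0 < R\<close> have *: "4 * w * S < min w \<epsilon> * (w + S + \<epsilon>)" by simp
    show False
    proof (cases "w \<le> \<epsilon>")
      case True
      with * have "w * (4 * S) < w * (w + S + \<epsilon>)" by simp
      with w have "4 * S < w + S + \<epsilon>" by (simp only: mult_less_cancel_left_pos)
      moreover have "2 * \<epsilon> * (5/8) \<le> 2 * \<epsilon> * (1 - w - 2 * \<epsilon>)"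
        using True \<epsilon> by (intro mult_left_mono) auto
      ultimately show False using True \<epsilon> S by simp
    next
      case False
      with * have "(4 * w - \<epsilon>) * S < \<epsilon> * (w + \<epsilon>)" by (simp add: algebra_simps)
      moreover have "(4 * w - \<epsilon>) * (2 * \<epsilon> * (1 - w - 2 * \<epsilon>)) \<le> (4 * w - \<epsilon>) * S"
        using False w S by (intro mult_left_mono) auto
      ultimately have "\<epsilon> * (2 * (4 * w - \<epsilon>) * (1 - w - 2 * \<epsilon>)) < \<epsilon> * (w + \<epsilon>)"
        by (simp add: algebra_simps)
      with \<epsilon> have "2 * (4 * w - \<epsilon>) * (1 - w - 2 * \<epsilon>) < w + \<epsilon>"
        by (simp only: mult_less_cancel_left_pos)
      moreover have "w + \<epsilon> \<le> 2 * (4 * w - \<epsilon>) * (1 - w - 2 * \<epsilon>)"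
      \<comment> \<open>Up to 5/12, \<epsilon> \<le> 1/8 gives 1 - w - 2\<epsilon> \<ge> 1/3, while
        4w - \<epsilon> \<ge> 3w. Beyond it, 4w - \<epsilon> \<ge> 37/24 makes up for the weaker
        bound 1/4.\<close>
      proof (cases "w \<le> 5/12")
        case True
        have "w + \<epsilon> \<le> 2 * (3 * w) * (1/3)" using False by simp
        also have "\<dots> \<le> 2 * (4 * w - \<epsilon>) * (1 - w - 2 * \<epsilon>)"
          using True False w \<epsilon> by (intro mult_mono) auto
        finally show ?thesis .
      next
        case False
        have "w + \<epsilon> \<le> 2 * (37/24) * (1/4)" using w \<epsilon> by simp
        also have "\<dots> \<le> 2 * (4 * w - \<epsilon>) * (1 - w - 2 * \<epsilon>)"
          using False w \<epsilon> by (intro mult_mono) auto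
        finally show ?thesis .
      qed
      ultimately show False by linarith
    qed
  qed
qed

section \<open>The isoperimetric inequality\<close>

theorem theorem6p1:
  fixes P d :: "'v::finite \<Rightarrow> 'v \<Rightarrow> real" and m :: "'v \<Rightarrow> real"
    and W :: "'v set" and \<epsilon> :: real
  assumes "markov_kernel P"
    and "symmetric_support P"
    and "path_distance P d"
    and "reversible_measure P m"
    and "\<forall>x y. adj P x y \<longrightarrow> 0 \<le> ollivier_curvature P d x y"
    and "sum m W \<le> 1/2"
    and "0 < \<epsilon>" and "\<epsilon> \<le> 1/8"
  shows "edge_boundary P d m W \<ge>
    P0 P d * (min (sum m W) \<epsilon> * ln (1/\<epsilon>)) / (6 * obs_diam P d m \<epsilon>)"
proof -
  interpret nonneg_curved_chain P d
    by unfold_locales (use assms in auto)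
  interpret reversible_chain P d m
    by unfold_locales (use assms in auto)
  define w D L where "w = sum m W" and "D = obs_diam P d m \<epsilon>" and "L = ln (1/\<epsilon>)"
  have "0 \<le> D" unfolding D_def using assms by (intro obs_diam_nonneg) auto
  have "0 \<le> w" unfolding w_def by (intro sum_nonneg) auto
  show ?thesis
  \<comment> \<open>In both degenerate cases the right-hand side is 0, for \<open>D = 0\<close>
    because division by zero yields 0.\<close>
  proof (cases "w = 0 \<or> D = 0")
    case True
    with edge_boundary_nonneg[of W] assms(7) show ?thesis by (auto simp: w_def D_def)
  next
    case False
    with \<open>0 \<le> D\<close> \<open>0 \<le> w\<close> have pos: "0 < w" "0 < D" by auto
    have "W \<noteq> {}" using pos by (auto simp: w_def)
    moreover have "W \<noteq> UNIV" using assms(6) by auto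
    ultimately obtain f C where f: "lipschitz1 d f" "\<forall>x\<in>W. C \<le> laplacian P f x"
        "\<forall>x\<in>-W. laplacian P f x \<le> C"
        "\<forall>y\<in>-W. \<exists>z. adj P y z \<and> f z = f y - d y z"
      by (rule laplacian_separation)
    have "\<epsilon> \<le> 1" using assms(8) by simp
    with assms(7) f(1) obtain s where s: "sum m (closure_nb P {x. f x < s}) < \<epsilon>"
        "sum m {x. s + D < f x} < \<epsilon>"
      unfolding D_def by (metis obs_diam_level_sets)
    define B where "B = edge_boundary P d m W"
    \<comment> \<open>With this rate, \<open>exp (- \<alpha> * D)\<close> is \<epsilon> to the power
      2/3, that is \<epsilon> times \<open>exp (L / 3)\<close>, which is at least 2\<epsilon>
      because \<epsilon> \<le> 1/8.\<close>
    define \<alpha> where "\<alpha> = 2/3 * (L / D)"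
    define \<psi> where "\<psi> = (\<lambda>x. exp (- \<alpha> * max 0 (f x - s)))"
    define N where "N = closure_nb P {x. f x < s}"
    define G where "G = - W - N"
    define S where "S = (\<Sum>y\<in>G. m y * \<psi> y)"
    define T where "T = (\<Sum>y\<in>UNIV. m y * \<psi> y)"
    have "ln 1 \<le> L" "ln 8 \<le> L" unfolding L_def using assms(7,8)
      by (subst ln_le_cancel_iff; simp add: field_simps)+
    then have L: "0 \<le> L" "3 * ln 2 \<le> L" using ln_realpow[of 2 3] by simp_all
    then have \<alpha>: "0 \<le> \<alpha>" using pos by (simp add: \<alpha>_def)
    have \<psi>_pos: "0 < \<psi> x" and \<psi>_le: "\<psi> x \<le> 1" for x
      using \<alpha> by (simp_all add: \<psi>_def mult_nonneg_nonneg)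
    have flux: "\<bar>\<Sum>x\<in>W. m x * laplacian P f x\<bar> \<le> B"
      unfolding B_def by (rule laplacian_mass_le_boundary[OF f(1)])
    have UNIV_split: "sum g UNIV = sum g W + sum g (- W)" for g :: "'v \<Rightarrow> real"
      by (subst sum.union_disjoint[symmetric]) (auto simp: Un_commute)
    have "C * w \<le> B"
    proof -
      have "C * w = (\<Sum>x\<in>W. m x * C)" by (simp add: w_def sum_distrib_left mult_ac)
      also have "\<dots> \<le> (\<Sum>x\<in>W. m x * laplacian P f x)"
        using f(2,3) by (intro sum_mono mult_left_mono) auto
      finally show ?thesis using flux by linarith
    qed
    moreover have "- C * (1 - w) \<le> B"
    proof -
      \<comment> \<open>The Laplacian has total mass zero, so the flux bound for \<open>W\<close>
        also controls its complement, of mass \<open>1 - w\<close>.\<close>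
      have "(\<Sum>x\<in>UNIV. m x * laplacian P f x) = 0"
        using green_formula[of "\<lambda>_. 1" f] by simp
      then have "- (\<Sum>x\<in>W. m x * laplacian P f x) = (\<Sum>x\<in>-W. m x * laplacian P f x)"
        using UNIV_split[of "\<lambda>x. m x * laplacian P f x"] by simp
      also have "\<dots> \<le> (\<Sum>x\<in>-W. m x * C)"
        using f(2,3) by (intro sum_mono mult_left_mono) auto
      also have "\<dots> = C * (1 - w)"
        using UNIV_split[of m] by (simp add: w_def flip: sum_distrib_right)
      finally show ?thesis using flux by linarith
    qed
    moreover have "2 * \<epsilon> * (1 - w - 2 * \<epsilon>) \<le> S"
    proof -
      \<comment> \<open>Passing to \<open>G'\<close> discards mass \<open>w\<close> and two portions
        below \<epsilon>; on what remains, \<psi> is at least 2\<epsilon>.\<close>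
      define G' where "G' = G - {x. s + D < f x}"
      have "\<epsilon> * 2 \<le> \<epsilon> * exp (L / 3)"
      proof -
        have "ln 2 \<le> L / 3" using L by simp
        then have "exp (ln 2) \<le> exp (L / 3)" by (simp only: exp_le_cancel_iff)
        then show ?thesis using assms(7) by simp
      qed
      also have "\<dots> = exp (- L) * exp (L / 3)"
        using assms(7) by (simp add: L_def exp_minus ln_div)
      also have "\<dots> = exp (- \<alpha> * D)" using pos by (simp add: \<alpha>_def flip: exp_add)
      finally have e: "2 * \<epsilon> \<le> exp (- \<alpha> * D)" by simp
      have lower: "2 * \<epsilon> \<le> \<psi> x" if "x \<in> G'" for x
      proof -
        have "max 0 (f x - s) \<le> D" using that pos by (auto simp: G'_def)
        then have "exp (- \<alpha> * D) \<le> \<psi> x" using \<alpha> by (simp add: \<psi>_def mult_left_mono)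
        with e show ?thesis by simp
      qed
      have "1 = sum m UNIV" by simp
      also have "\<dots> \<le> sum m (W \<union> N \<union> {x. s + D < f x} \<union> G')"
        by (intro sum_mono2) (auto simp: G'_def G_def)
      also have "\<dots> \<le> sum m W + sum m N + sum m {x. s + D < f x} + sum m G'"
        by (intro order_trans[OF sum_Un_le] add_mono order_refl)
      finally have "1 - w - 2 * \<epsilon> \<le> sum m G'" using s by (simp add: w_def N_def)
      then have "2 * \<epsilon> * (1 - w - 2 * \<epsilon>) \<le> 2 * \<epsilon> * sum m G'"
        using assms(7) by (intro mult_left_mono) auto
      also have "\<dots> = sum m G' * (2 * \<epsilon>)" by (rule mult.commute)
      also have "\<dots> = (\<Sum>y\<in>G'. m y * (2 * \<epsilon>))" by (rule sum_distrib_right)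
      also have "\<dots> \<le> (\<Sum>y\<in>G'. m y * \<psi> y)"
        by (intro sum_mono mult_left_mono lower) auto
      also have "\<dots> \<le> S" unfolding S_def
        by (intro sum_mono2) (auto simp: G'_def less_imp_le[OF \<psi>_pos])
      finally show ?thesis .
    qed
    moreover have "S \<le> T" unfolding S_def T_def
      by (intro sum_mono2) (auto simp: less_imp_le[OF \<psi>_pos])
    moreover have "T \<le> S + w + \<epsilon>"
    proof -
      have "T = S + (\<Sum>y\<in>W \<union> N. m y * \<psi> y)"
        unfolding T_def S_def
        by (subst sum.union_disjoint[symmetric]) (auto simp: G_def intro!: sum.cong)
      also have "(\<Sum>y\<in>W \<union> N. m y * \<psi> y) \<le> sum m (W \<union> N)"
        by (intro sum_mono mult_left_le) (auto simp: \<psi>_le)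
      also have "\<dots> \<le> sum m W + sum m N" by (rule sum_Un_le)
      finally show ?thesis using s by (simp add: w_def N_def)
    qed
    moreover have "2/3 * (P0 P d * L / D) * S \<le> B + C * (T - w)"
    proof -
      have "2/3 * (P0 P d * L / D) * S = \<alpha> * P0 P d * S" by (simp add: \<alpha>_def)
      also have "\<dots> \<le> (\<Sum>x\<in>UNIV. m x * \<psi> x * laplacian P f x)"
        unfolding S_def
      proof (rule energy_lower_bound[OF f(1) \<alpha> \<psi>_def])
        fix y assume y: "y \<in> G"
        with f(4) obtain z where z: "adj P y z" "f z = f y - d y z" by (auto simp: G_def)
        \<comment> \<open>A vertex outside the closure of the sublevel set has no neighbour in that
          set.\<close>
        moreover from y z(1) have "s \<le> f z" by (auto simp: G_def N_def closure_nb_def not_less)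
        ultimately show "\<exists>z. adj P y z \<and> f z = f y - d y z \<and> s \<le> f z" by blast
      qed
      also have "\<dots> = C * T + (\<Sum>x\<in>UNIV. m x * \<psi> x * (laplacian P f x - C))"
        unfolding T_def sum_distrib_left sum.distrib[symmetric]
        by (intro sum.cong refl) (simp add: algebra_simps)
      \<comment> \<open>After subtracting \<open>C\<close>, the terms off \<open>W\<close> are
        non-positive and drop out; those on \<open>W\<close> are non-negative, so \<psi> can be
        replaced by 1.\<close>
      also have "(\<Sum>x\<in>UNIV. m x * \<psi> x * (laplacian P f x - C)) \<le>
          (\<Sum>x\<in>W. m x * \<psi> x * (laplacian P f x - C))"
        unfolding UNIV_split using f(3)
        by (simp, intro sum_nonpos mult_nonneg_nonpos) (auto simp: less_imp_le[OF \<psi>_pos])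
      also have "\<dots> \<le> (\<Sum>x\<in>W. m x * (laplacian P f x - C))"
        using f(2) by (intro sum_mono mult_right_mono mult_left_le) (auto simp: \<psi>_le)
      also have "\<dots> = (\<Sum>x\<in>W. m x * laplacian P f x) - C * w"
        unfolding w_def sum_distrib_left sum_subtractf[symmetric]
        by (intro sum.cong refl) (simp add: algebra_simps)
      finally show ?thesis using flux by (simp add: algebra_simps)
    qed
    moreover have "0 \<le> P0 P d * L / D"
    proof -
      from \<open>W \<noteq> UNIV\<close> f(4) obtain y z where "adj P y z" by blast
      then have "0 \<le> P0 P d" unfolding P0_def by (intro cInf_greatest) auto
      with L pos show ?thesis by simp
    qed
    ultimately have "P0 P d * L / D * min w \<epsilon> / 6 \<le> B"
      using pos(1) assms(6-8)[folded w_def]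
      by (intro isoperimetric_arithmetic[where C = C and S = S and T = T])
    then show ?thesis by (simp add: B_def w_def D_def L_def mult_ac)
  qed
qed

end
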